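(* Let $p\in[0,1]$, let $n\ge k$ be in $\mathbb{N}$, let $X$ be an $n$-element set and let $g\colon\binom{X}{k}\to[0,1]$ be a function. If $w(g,p)=1$, then there exists $G\subseteq\operatorname{supp}(g)$ with $\langle g\rangle\subseteq\langle G\rangle$ and $$w\left(G,\frac{p}{4\cdot n^{1/k}}\right)\le 1.$$ In particular, for $k\ge C\log_2(n)$ with some $C>0$, it holds that if $w(g,p)=1$ then there exists $G\subseteq\operatorname{supp}(g)$ with $\langle g\rangle\subseteq\langle G\rangle$ and $$w\left(G,\frac{p}{4\cdot 2^{1/C}}\right)\le 1.$$
   Context: $\mathbb{N}=\{1,2,\dots\}$. For a finite set $X$, $2^X$ is its power set and $\binom{X}{k}$ is the set of $k$-element subsets of $X$. For $p\in[0,1]$, $G\subseteq 2^X$ and $g\colon 2^X\to[0,\infty)$ define $$w(G,p):=\sum_{T\in G}p^{|T|},\qquad w(g,p):=\sum_{T\in 2^X}g(T)\,p^{|T|},$$ $$\langle G\rangle:=\{S\in 2^X : \text{there is } T\in G \text{ with } T\subseteq S\},\qquad \langle g\rangle:=\Big\{S\in 2^X : \sum_{T\subseteq S}g(T)\ge 1\Big\}.$$ A function defined only on $\binom{X}{k}$ is regarded as a function on $2^X$ by setting it to $0$ outside $\binom{X}{k}$. The support of $g$ is $\operatorname{supp}(g):=\{S : g(S)\ne 0\}$. *)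

theory Defs
  imports Complex_Main "HOL-Library.FuncSet" "HOL-Library.Ramsey"
begin

text \<open>
  The set of \<open>k\<close>-element subsets of \<open>X\<close> is \<^const>\<open>nsets\<close> from the library.
  Functions on \<open>2\<^sup>X\<close> are HOL functions on all sets of type \<open>'a set\<close>, whose values outside
  \<open>Pow X\<close> are irrelevant; the ground set \<open>X\<close> is therefore an explicit parameter below.
\<close>

definition weight_sets :: "'a set set \<Rightarrow> real \<Rightarrow> real" where
  "weight_sets G p = (\<Sum>T\<in>G. p ^ card T)"

definition weight_fun :: "'a set \<Rightarrow> ('a set \<Rightarrow> real) \<Rightarrow> real \<Rightarrow> real" where
  "weight_fun X g p = (\<Sum>T\<in>Pow X. g T * p ^ card T)"

definition upset_sets :: "'a set \<Rightarrow> 'a set set \<Rightarrow> 'a set set" where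
  "upset_sets X G = {S \<in> Pow X. \<exists>T\<in>G. T \<subseteq> S}"

definition upset_fun :: "'a set \<Rightarrow> ('a set \<Rightarrow> real) \<Rightarrow> 'a set set" where
  "upset_fun X g = {S \<in> Pow X. (\<Sum>T\<in>Pow S. g T) \<ge> 1}"

definition supp :: "'a set \<Rightarrow> ('a set \<Rightarrow> real) \<Rightarrow> 'a set set" where
  "supp X g = {S \<in> Pow X. g S \<noteq> 0}"

definition zero_ext :: "'a set set \<Rightarrow> ('a set \<Rightarrow> real) \<Rightarrow> 'a set \<Rightarrow> real" where
  "zero_ext D g T = (if T \<in> D then g T else 0)"

end

theory Submission
  imports Defs
begin

text \<open>
  Write \<open>M = p\<^sup>-\<^sup>k\<close>. Since \<open>g\<close> lives on \<open>k\<close>-element sets, \<open>w(g, p) = 1\<close> says that \<open>g\<close> has total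
  mass \<open>M\<close>, and a family \<open>G\<close> of \<open>k\<close>-element sets satisfies \<open>w(G, p / (4 n\<^bsup>1/k\<^esup>)) \<le> 1\<close> exactly when
  \<open>G\<close> has at most \<open>4\<^sup>k n M\<close> members. The members of \<open>\<langle>g\<rangle>\<close> are the sets \<open>S\<close> whose subsets carry mass
  at least \<open>1\<close>, so \<open>g\<close> is a fractional cover of \<open>\<langle>g\<rangle>\<close> of total mass \<open>M\<close>, and the claim is that it
  can be rounded to an integral one at the cost of a factor \<open>4\<^sup>k n\<close>.

  Greedy rounding is good enough. By averaging, some set in the support lies below at least a
  fraction \<open>1 / M\<close> of the members of \<open>\<langle>g\<rangle>\<close> that are still uncovered (\<open>averaging_cover\<close>). Hence
  after \<open>N\<close> choices at most \<open>(1 - 1 / M)\<^sup>N 2\<^sup>n \<le> exp (- N / M) 2\<^sup>n\<close> of them remain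
  (\<open>greedy_cover\<close>), which is less than one as soon as \<open>N \<ge> n M\<close> (\<open>logarithmic_cover\<close>). As
  \<open>M \<ge> 1\<close>, such an \<open>N\<close> exists with \<open>N \<le> 2 n M \<le> 4\<^sup>k n M\<close>.

  The second claim holds for the same \<open>G\<close>: the assumption on \<open>k\<close> means \<open>n\<^bsup>1/k\<^esup> \<le> 2\<^bsup>1/C\<^esup>\<close>, and the weight of
  \<open>G\<close> is monotone in \<open>p\<close>.
\<close>

text \<open>
  Double counting gives \<open>\<Sum>\<^sub>T g(T) |{S \<in> F. R T S}| = \<Sum>\<^sub>S \<Sum>\<^sub>T g(T) [R T S] \<ge> |F|\<close>. If every candidate
  covered fewer than \<open>|F| / M\<close> targets, the left-hand side would be less than \<open>|F|\<close>, because \<open>g\<close> has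
  total mass at most \<open>M\<close>.
\<close>

lemma averaging_cover:
  fixes g :: "'b \<Rightarrow> real" and R :: "'b \<Rightarrow> 's \<Rightarrow> bool"
  assumes "finite B" "finite F" "F \<noteq> {}"
    and pos: "\<And>T. T \<in> B \<Longrightarrow> g T > 0"
    and mass: "sum g B \<le> M"
    and cover: "\<And>S. S \<in> F \<Longrightarrow> sum g {T \<in> B. R T S} \<ge> 1"
  shows "\<exists>T\<in>B. real (card F) \<le> M * real (card {S \<in> F. R T S})"
proof (rule ccontr)
  assume "\<not> ?thesis"
  then have few: "M * real (card {S \<in> F. R T S}) < real (card F)" if "T \<in> B" for T
    using that by force
  obtain S where "S \<in> F" using \<open>F \<noteq> {}\<close> by blast
  with cover have "B \<noteq> {}" by force
  have "M \<ge> 0"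
    using sum_nonneg[of B g] pos mass by (force intro: less_imp_le)
  have "real (card F) = (\<Sum>S\<in>F. 1)" by simp
  also have "\<dots> \<le> (\<Sum>S\<in>F. sum g {T \<in> B. R T S})"
    by (intro sum_mono cover)
  also have "\<dots> = (\<Sum>S\<in>F. \<Sum>T\<in>B. if R T S then g T else 0)"
    using \<open>finite B\<close> by (simp add: sum.inter_filter)
  also have "\<dots> = (\<Sum>T\<in>B. \<Sum>S\<in>F. if R T S then g T else 0)"
    by (rule sum.swap)
  also have "\<dots> = (\<Sum>T\<in>B. g T * real (card {S \<in> F. R T S}))"
    using \<open>finite F\<close> by (simp add: sum.inter_filter[symmetric] mult.commute)
  finally have "M * real (card F) \<le> M * (\<Sum>T\<in>B. g T * real (card {S \<in> F. R T S}))"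
    using \<open>M \<ge> 0\<close> by (rule mult_left_mono)
  also have "\<dots> = (\<Sum>T\<in>B. g T * (M * real (card {S \<in> F. R T S})))"
    by (simp add: sum_distrib_left mult_ac)
  also have "\<dots> < (\<Sum>T\<in>B. g T * real (card F))"
    using \<open>finite B\<close> \<open>B \<noteq> {}\<close> by (intro sum_strict_mono mult_strict_left_mono few pos)
  also have "\<dots> = sum g B * real (card F)"
    by (simp add: sum_distrib_right)
  also have "\<dots> \<le> M * real (card F)"
    using mass by (intro mult_right_mono) auto
  finally show False by simp
qed

text \<open>
  A fractional cover of all targets is in particular one of the targets still uncovered, with the
  same mass, so the averaging argument yields the same ratio \<open>1 / M\<close> at every step.
\<close>

lemma greedy_cover:
  fixes g :: "'b \<Rightarrow> real" and R :: "'b \<Rightarrow> 's \<Rightarrow> bool"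
  assumes "finite B" "finite F"
    and pos: "\<And>T. T \<in> B \<Longrightarrow> g T > 0"
    and mass: "sum g B \<le> M" "M \<ge> 1"
    and cover: "\<And>S. S \<in> F \<Longrightarrow> sum g {T \<in> B. R T S} \<ge> 1"
  shows "\<exists>G\<subseteq>B. card G \<le> N \<and>
           real (card {S \<in> F. \<forall>T\<in>G. \<not> R T S}) \<le> (1 - 1 / M) ^ N * real (card F)"
proof (induction N)
  case 0
  show ?case by (intro exI[of _ "{}"]) simp
next
  case (Suc N)
  then obtain G where G: "G \<subseteq> B" "card G \<le> N"
    and left: "real (card {S \<in> F. \<forall>T\<in>G. \<not> R T S}) \<le> (1 - 1 / M) ^ N * real (card F)"
    by blast
  define U where "U = {S \<in> F. \<forall>T\<in>G. \<not> R T S}"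
  have "U \<subseteq> F" "finite U" using \<open>finite F\<close> by (auto simp: U_def)
  show ?case
  proof (cases "U = {}")
    case True
    then show ?thesis
      using G \<open>M \<ge> 1\<close> unfolding U_def[symmetric] by (intro exI[of _ G]) (simp flip: U_def)
  next
    case False
    have "\<exists>T\<in>B. real (card U) \<le> M * real (card {S \<in> U. R T S})"
    proof (rule averaging_cover[OF \<open>finite B\<close> \<open>finite U\<close> False _ mass(1)])
      show "sum g {T \<in> B. R T S} \<ge> 1" if "S \<in> U" for S
        using cover \<open>U \<subseteq> F\<close> that by blast
    qed (fact pos)
    then obtain T where T: "T \<in> B" "real (card U) \<le> M * real (card {S \<in> U. R T S})"
      by blast
    have rest: "{S \<in> F. \<forall>T'\<in>insert T G. \<not> R T' S} = U - {S \<in> U. R T S}"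
      by (auto simp: U_def)
    have "card {S \<in> U. R T S} \<le> card U"
      using \<open>finite U\<close> by (intro card_mono) auto
    then have "real (card (U - {S \<in> U. R T S})) = real (card U) - real (card {S \<in> U. R T S})"
      using \<open>finite U\<close> by (simp add: card_Diff_subset of_nat_diff)
    also have "\<dots> \<le> (1 - 1 / M) * real (card U)"
      using T(2) \<open>M \<ge> 1\<close> by (simp add: field_simps)
    also have "\<dots> \<le> (1 - 1 / M) * ((1 - 1 / M) ^ N * real (card F))"
      using left \<open>M \<ge> 1\<close> unfolding U_def by (intro mult_left_mono) auto
    finally have "real (card {S \<in> F. \<forall>T'\<in>insert T G. \<not> R T' S})
        \<le> (1 - 1 / M) ^ Suc N * real (card F)"
      unfolding rest by (simp add: mult_ac)
    moreover have "card (insert T G) \<le> Suc N"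
      using card_insert_le_m1[of "Suc N" G T] G(2) by simp
    ultimately show ?thesis
      using G(1) T(1) by (intro exI[of _ "insert T G"]) auto
  qed
qed

text \<open>
  The threshold \<open>n M\<close> comes from \<open>(1 - 1 / M)\<^sup>N \<le> exp (- N / M) \<le> exp (- n) < 2\<^sup>-\<^sup>n\<close>; rounding it up to
  an integer costs at most another \<open>n M\<close>, because \<open>n M \<ge> 1\<close>.
\<close>

lemma logarithmic_cover:
  fixes g :: "'b \<Rightarrow> real" and R :: "'b \<Rightarrow> 's \<Rightarrow> bool"
  assumes "finite B" "finite F"
    and pos: "\<And>T. T \<in> B \<Longrightarrow> g T > 0"
    and mass: "sum g B \<le> M" "M \<ge> 1"
    and cover: "\<And>S. S \<in> F \<Longrightarrow> sum g {T \<in> B. R T S} \<ge> 1"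
    and "n \<ge> 1" "card F \<le> 2 ^ n"
  shows "\<exists>G\<subseteq>B. real (card G) \<le> 2 * real n * M \<and> (\<forall>S\<in>F. \<exists>T\<in>G. R T S)"
proof -
  define N where "N = nat \<lceil>real n * M\<rceil>"
  have "real n * M \<ge> 1"
    using mult_mono[of 1 "real n" 1 M] \<open>n \<ge> 1\<close> \<open>M \<ge> 1\<close> by simp
  then have N: "real N \<ge> real n * M" "real N \<le> 2 * real n * M"
    unfolding N_def by linarith+
  have "\<exists>G\<subseteq>B. card G \<le> N \<and>
      real (card {S \<in> F. \<forall>T\<in>G. \<not> R T S}) \<le> (1 - 1 / M) ^ N * real (card F)"
    by (rule greedy_cover[OF \<open>finite B\<close> \<open>finite F\<close> _ mass]) (fact pos cover)+
  then obtain G where G: "G \<subseteq> B" "card G \<le> N"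
    and left: "real (card {S \<in> F. \<forall>T\<in>G. \<not> R T S}) \<le> (1 - 1 / M) ^ N * real (card F)"
    by blast
  have "(1 - 1 / M) ^ N \<le> exp (- (1 / M)) ^ N"
    using exp_ge_add_one_self[of "- (1 / M)"] \<open>M \<ge> 1\<close> by (intro power_mono) auto
  also have "\<dots> = exp (- (real N / M))"
    by (simp add: exp_of_nat_mult[symmetric])
  also have "\<dots> \<le> exp (- real n)"
    using N(1) \<open>M \<ge> 1\<close> by (simp add: field_simps)
  finally have decay: "(1 - 1 / M) ^ N \<le> exp (- real n)" .
  have "(2::real) < exp 1"
    using exp_lower_Taylor_quadratic[of 1] by simp
  then have "(2::real) ^ n < exp 1 ^ n"
    using \<open>n \<ge> 1\<close> by (intro power_strict_mono) auto
  then have small: "(2::real) ^ n < exp (real n)"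
    by (simp add: exp_of_nat_mult[symmetric])
  have "real (card {S \<in> F. \<forall>T\<in>G. \<not> R T S}) \<le> exp (- real n) * 2 ^ n"
  proof -
    have "real (card F) \<le> 2 ^ n"
      using \<open>card F \<le> 2 ^ n\<close> by (metis of_nat_le_iff of_nat_numeral of_nat_power)
    then show ?thesis
      using left mult_mono[OF decay, of "real (card F)" "2 ^ n"] by simp
  qed
  also have "\<dots> < 1"
    using small by (simp add: exp_minus field_simps)
  finally have "{S \<in> F. \<forall>T\<in>G. \<not> R T S} = {}"
    using \<open>finite F\<close> by simp
  then have "\<forall>S\<in>F. \<exists>T\<in>G. R T S" by blast
  moreover have "real (card G) \<le> 2 * real n * M"
    using G(2) N(2) by linarith
  ultimately show ?thesis using G(1) by blast
qed

lemma weight_sets_uniform: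
  assumes "\<And>T. T \<in> G \<Longrightarrow> card T = k"
  shows "weight_sets G q = real (card G) * q ^ k"
  using assms by (simp add: weight_sets_def)

lemma weight_sets_mono:
  assumes "0 \<le> q" "q \<le> r"
  shows "weight_sets G q \<le> weight_sets G r"
  unfolding weight_sets_def by (intro sum_mono power_mono assms)

theorem theorem10:
  fixes p :: real and n k :: nat and X :: "'a set" and g :: "'a set \<Rightarrow> real"
  assumes "0 \<le> p" and "p \<le> 1"
    and "1 \<le> k" and "k \<le> n"
    and "finite X" and "card X = n"
    and "g \<in> nsets X k \<rightarrow> {0..1}"
    and "weight_fun X (zero_ext (nsets X k) g) p = 1"
  shows "(\<exists>G. G \<subseteq> supp X (zero_ext (nsets X k) g)
            \<and> upset_fun X (zero_ext (nsets X k) g) \<subseteq> upset_sets X G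
            \<and> weight_sets G (p / (4 * real n powr (1 / real k))) \<le> 1)
       \<and> (\<forall>C::real. C > 0 \<longrightarrow> real k \<ge> C * log 2 (real n) \<longrightarrow>
            (\<exists>G. G \<subseteq> supp X (zero_ext (nsets X k) g)
               \<and> upset_fun X (zero_ext (nsets X k) g) \<subseteq> upset_sets X G
               \<and> weight_sets G (p / (4 * 2 powr (1 / C))) \<le> 1))"
proof -
  define f where "f = zero_ext (nsets X k) g"
  define M where "M = sum f (Pow X)"
  define q where "q = p / (4 * real n powr (1 / real k))"
  have "n \<ge> 1" using assms(3,4) by simp
  have f_nonneg: "f T \<ge> 0" for T
    using assms(7) by (auto simp: f_def zero_ext_def Pi_iff)
  have f_card: "card T = k" if "f T \<noteq> 0" for T
    using that by (auto simp: f_def zero_ext_def nsets_def split: if_splits)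
  have fin_supp: "finite (supp X f)"
    using \<open>finite X\<close> by (simp add: supp_def)
  have "1 = (\<Sum>T\<in>Pow X. f T * p ^ card T)"
    using assms(8) by (simp add: weight_fun_def f_def)
  also have "\<dots> = (\<Sum>T\<in>Pow X. f T * p ^ k)"
    using f_card by (intro sum.cong refl) fastforce
  finally have Mp: "M * p ^ k = 1"
    by (simp add: M_def sum_distrib_right)
  have "p ^ k \<le> 1"
    using assms(1,2) by (rule power_le_one)
  have "M \<ge> 0"
    unfolding M_def using f_nonneg by (intro sum_nonneg)
  have "M \<ge> 1"
    using mult_left_mono[OF \<open>p ^ k \<le> 1\<close> \<open>M \<ge> 0\<close>] Mp by simp
  have mass: "sum f (supp X f) \<le> M"
    unfolding M_def supp_def using \<open>finite X\<close> f_nonneg by (intro sum_mono2) auto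
  have cover: "sum f {T \<in> supp X f. T \<subseteq> S} \<ge> 1" if "S \<in> upset_fun X f" for S
  proof -
    have "S \<subseteq> X" and big: "sum f (Pow S) \<ge> 1"
      using that by (auto simp: upset_fun_def)
    have "sum f {T \<in> supp X f. T \<subseteq> S} = sum f (Pow S)"
      using \<open>S \<subseteq> X\<close> \<open>finite X\<close> finite_subset[OF \<open>S \<subseteq> X\<close>]
      by (intro sum.mono_neutral_left) (auto simp: supp_def)
    then show ?thesis using big by simp
  qed
  have sub: "upset_fun X f \<subseteq> Pow X"
    by (auto simp: upset_fun_def)
  have few: "card (upset_fun X f) \<le> 2 ^ n"
    using card_mono[OF _ sub] \<open>finite X\<close> \<open>card X = n\<close> by (simp add: card_Pow)
  have fin: "finite (upset_fun X f)"
    using finite_subset[OF sub] \<open>finite X\<close> by simp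
  have pos: "f T > 0" if "T \<in> supp X f" for T
    using that f_nonneg[of T] by (simp add: supp_def)
  have "\<exists>G\<subseteq>supp X f. real (card G) \<le> 2 * real n * M \<and> (\<forall>S\<in>upset_fun X f. \<exists>T\<in>G. T \<subseteq> S)"
    by (rule logarithmic_cover[OF fin_supp fin _ mass \<open>M \<ge> 1\<close> _ \<open>n \<ge> 1\<close> few])
      (fact pos cover)+
  then obtain G where G: "G \<subseteq> supp X f" "real (card G) \<le> 2 * real n * M"
      "\<forall>S\<in>upset_fun X f. \<exists>T\<in>G. T \<subseteq> S"
    by blast
  have covered: "upset_fun X f \<subseteq> upset_sets X G"
    using G(3) sub by (auto simp: upset_sets_def)
  have "(real n powr (1 / real k)) ^ k = real n"
    using \<open>n \<ge> 1\<close> \<open>1 \<le> k\<close> by (simp add: powr_power)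
  then have qk: "q ^ k = p ^ k / (4 ^ k * real n)"
    by (simp add: q_def power_divide power_mult_distrib)
  have "(2::real) \<le> 4 ^ k"
    using power_increasing[OF \<open>1 \<le> k\<close>, of "4::real"] by simp
  have "weight_sets G q = real (card G) * q ^ k"
    using G(1) f_card by (intro weight_sets_uniform) (auto simp: supp_def)
  also have "\<dots> \<le> (2 * real n * M) * q ^ k"
    using G(2) \<open>0 \<le> p\<close> by (intro mult_right_mono) (auto simp: q_def)
  also have "\<dots> = 2 * (M * p ^ k) / 4 ^ k"
    using \<open>n \<ge> 1\<close> by (simp add: qk)
  also have "\<dots> \<le> 1"
    using \<open>2 \<le> 4 ^ k\<close> by (simp add: Mp)
  finally have light: "weight_sets G q \<le> 1" .
  have "weight_sets G (p / (4 * 2 powr (1 / C))) \<le> 1"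
    if "C > 0" "real k \<ge> C * log 2 (real n)" for C :: real
  proof -
    have "real n powr (1 / real k) = 2 powr (log 2 (real n) / real k)"
      using \<open>n \<ge> 1\<close> by (simp add: powr_powr[symmetric] divide_inverse)
    also have "\<dots> \<le> 2 powr (1 / C)"
      using that \<open>1 \<le> k\<close> by (simp add: field_simps)
    finally have "p / (4 * 2 powr (1 / C)) \<le> q"
      unfolding q_def using \<open>n \<ge> 1\<close> \<open>0 \<le> p\<close> by (intro divide_left_mono) auto
    then show ?thesis
      using weight_sets_mono[of "p / (4 * 2 powr (1 / C))" q G] \<open>0 \<le> p\<close> light by simp
  qed
  then show ?thesis
    using G(1) covered light unfolding f_def q_def by blast
qed

end
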